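(* Let $(\gamma,\nu_1,\nu_2):I\to\mathbb{R}^3\times\Delta$ and $(\tilde\gamma,\tilde\nu_1,\tilde\nu_2):J\to\mathbb{R}^3\times\Delta$ be framed curves with curvatures $(\ell,m,n,\alpha)$ and $(\tilde\ell,\tilde m,\tilde n,\tilde\alpha)$ and frame matrix $T=(t_{ij})$, and let $\mathbf{x}:I\times J\to\mathbb{R}^3$, $\mathbf{x}(u,v)=\gamma(u)+\tilde\gamma(v)$, be their translation surface. (1) With $\nu_i(u,v)=\nu_i(u)$, $i=1,2$, $(\mathbf{x},\nu_1,\nu_2):I\times J\to\mathbb{R}^3\times\Delta$ is a generalised framed surface with basic invariants $$\begin{pmatrix} a_1 & b_1 & c_1 \\ a_2 & b_2 & c_2 \end{pmatrix}(u,v)=\begin{pmatrix} 0 & 0 & \alpha(u) \\ \tilde\alpha(v)t_{31}(u,v) & \tilde\alpha(v)t_{32}(u,v) & \tilde\alpha(v)t_{33}(u,v) \end{pmatrix},$$ $$\begin{pmatrix} e_1 & f_1 & g_1 \\ e_2 & f_2 & g_2 \end{pmatrix}(u,v)=\begin{pmatrix} \ell(u) & m(u) & n(u) \\ 0 & 0 & 0 \end{pmatrix},$$ $$A(u,v)=-\alpha(u)\tilde\alpha(v)t_{32}(u,v),\qquad B(u,v)=\alpha(u)\tilde\alpha(v)t_{31}(u,v).$$ (2) With $\tilde\nu_i(u,v)=\tilde\nu_i(v)$, $i=1,2$, $(\mathbf{x},\tilde\nu_1,\tilde\nu_2):I\times J\to\mathbb{R}^3\times\Delta$ is a generalised framed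 surface with basic invariants $$\begin{pmatrix} a_1 & b_1 & c_1 \\ a_2 & b_2 & c_2 \end{pmatrix}(u,v)=\begin{pmatrix} \alpha(u)t_{13}(u,v) & \alpha(u)t_{23}(u,v) & \alpha(u)t_{33}(u,v) \\ 0 & 0 & \tilde\alpha(v) \end{pmatrix},$$ $$\begin{pmatrix} e_1 & f_1 & g_1 \\ e_2 & f_2 & g_2 \end{pmatrix}(u,v)=\begin{pmatrix} 0 & 0 & 0 \\ \tilde\ell(v) & \tilde m(v) & \tilde n(v) \end{pmatrix},$$ $$A(u,v)=\alpha(u)\tilde\alpha(v)t_{23}(u,v),\qquad B(u,v)=-\alpha(u)\tilde\alpha(v)t_{13}(u,v).$$
   Context: All maps are $C^\infty$. $I,J\subset\mathbb{R}$ are intervals, with parameters $u\in I$, $v\in J$; subscripts $u,v$ denote derivatives (except in $a_i,b_i,\dots$). $S^2$ is the unit sphere in $\mathbb{R}^3$ and $\Delta=\{(a,b)\in S^2\times S^2 : a\cdot b=0\}$. A framed curve is a smooth map $(\gamma,\nu_1,\nu_2):I\to\mathbb{R}^3\times\Delta$ with $\gamma_u\cdot\nu_1=\gamma_u\cdot\nu_2=0$ on $I$. Put $\mu=\nu_1\times\nu_2$. Its curvature is $(\ell,m,n,\alpha)$ with $\ell=\nu_{1u}\cdot\nu_2$, $m=\nu_{1u}\cdot\mu$, $n=\nu_{2u}\cdot\mu$, $\alpha=\gamma_u\cdot\mu$. The same notation with tildes is used for a framed curve on $J$ with parameter $v$. The frame matrix of the two framed curves is $T=(t_{ij}):I\times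 J\to SO(3)$ determined by $$\begin{pmatrix} \tilde\nu_1(v) \\ \tilde\nu_2(v) \\ \tilde\mu(v) \end{pmatrix}=T(u,v)\begin{pmatrix} \nu_1(u) \\ \nu_2(u) \\ \mu(u) \end{pmatrix}.$$ A smooth map $(\mathbf{x},N_1,N_2):U\to\mathbb{R}^3\times\Delta$ on a simply connected domain $U$ is a generalised framed surface if there are smooth functions $A,B:U\to\mathbb{R}$ with $\mathbf{x}_u\times\mathbf{x}_v=AN_1+BN_2$. Put $N_3=N_1\times N_2$. Its basic invariants are the functions $a_i,b_i,c_i,e_i,f_i,g_i$ ($i=1,2$) given by $a_1=\mathbf{x}_u\cdot N_1$, $b_1=\mathbf{x}_u\cdot N_2$, $c_1=\mathbf{x}_u\cdot N_3$, $a_2=\mathbf{x}_v\cdot N_1$, $b_2=\mathbf{x}_v\cdot N_2$, $c_2=\mathbf{x}_v\cdot N_3$, $e_1=N_{1u}\cdot N_2$, $f_1=N_{1u}\cdot N_3$, $g_1=N_{2u}\cdot N_3$, $e_2=N_{1v}\cdot N_2$, $f_2=N_{1v}\cdot N_3$, $g_2=N_{2v}\cdot N_3$. *)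

theory Defs
  imports "HOL-Analysis.Analysis"
begin

text \<open>
  Derivatives are taken within the domain, so intervals and rectangles may contain
  boundary points; at interior points these are the ordinary derivatives.
  \<open>frechet_derivative\<close> and \<open>vector_derivative\<close> within a set are meaningful only where
  the derivative is unique. This holds on all domains used below: nondegenerate intervals
  and sets satisfying \<open>planar_domain\<close>.
\<close>

primrec Ck_on :: "nat \<Rightarrow> 'a::real_normed_vector set \<Rightarrow> ('a \<Rightarrow> 'b::real_normed_vector) \<Rightarrow> bool"
where
  "Ck_on 0 S f \<longleftrightarrow> continuous_on S f"
| "Ck_on (Suc k) S f \<longleftrightarrow>
     f differentiable_on S \<and> (\<forall>h. Ck_on k S (\<lambda>x. frechet_derivative f (at x within S) h))"

definition smooth_on :: "'a::real_normed_vector set \<Rightarrow> ('a \<Rightarrow> 'b::real_normed_vector) \<Rightarrow> bool"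
  where "smooth_on S f \<longleftrightarrow> (\<forall>k. Ck_on k S f)"

definition Delta :: "((real^3) \<times> (real^3)) set"
  where "Delta = {(a, b). a \<in> sphere 0 1 \<and> b \<in> sphere 0 1 \<and> a \<bullet> b = 0}"


subsection \<open>Framed curves\<close>

definition framed_curve ::
  "real set \<Rightarrow> (real \<Rightarrow> real^3) \<Rightarrow> (real \<Rightarrow> real^3) \<Rightarrow> (real \<Rightarrow> real^3) \<Rightarrow> bool"
where
  "framed_curve I \<gamma> \<nu>1 \<nu>2 \<longleftrightarrow>
     smooth_on I (\<lambda>u. (\<gamma> u, \<nu>1 u, \<nu>2 u)) \<and>
     (\<forall>u\<in>I. (\<nu>1 u, \<nu>2 u) \<in> Delta) \<and>
     (\<forall>u\<in>I. vector_derivative \<gamma> (at u within I) \<bullet> \<nu>1 u = 0 \<and>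
            vector_derivative \<gamma> (at u within I) \<bullet> \<nu>2 u = 0)"

definition frame_normal :: "(real \<Rightarrow> real^3) \<Rightarrow> (real \<Rightarrow> real^3) \<Rightarrow> real \<Rightarrow> real^3"
  where "frame_normal \<nu>1 \<nu>2 u = cross3 (\<nu>1 u) (\<nu>2 u)"

text \<open>The quadruple \<open>(\<ell>, m, n, \<alpha>)\<close>; \<open>frame_normal \<nu>1 \<nu>2\<close> is \<open>\<mu>\<close>.\<close>

definition curvature ::
  "real set \<Rightarrow> (real \<Rightarrow> real^3) \<Rightarrow> (real \<Rightarrow> real^3) \<Rightarrow> (real \<Rightarrow> real^3)
     \<Rightarrow> real \<Rightarrow> real \<times> real \<times> real \<times> real"
where
  "curvature I \<gamma> \<nu>1 \<nu>2 u =
     (vector_derivative \<nu>1 (at u within I) \<bullet> \<nu>2 u,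
      vector_derivative \<nu>1 (at u within I) \<bullet> frame_normal \<nu>1 \<nu>2 u,
      vector_derivative \<nu>2 (at u within I) \<bullet> frame_normal \<nu>1 \<nu>2 u,
      vector_derivative \<gamma> (at u within I) \<bullet> frame_normal \<nu>1 \<nu>2 u)"

text \<open>The matrix with rows \<open>\<nu>1 u\<close>, \<open>\<nu>2 u\<close>, \<open>\<mu> u\<close>.\<close>

definition moving_frame :: "(real \<Rightarrow> real^3) \<Rightarrow> (real \<Rightarrow> real^3) \<Rightarrow> real \<Rightarrow> real^3^3"
  where "moving_frame \<nu>1 \<nu>2 u = vector [\<nu>1 u, \<nu>2 u, frame_normal \<nu>1 \<nu>2 u]"

definition frame_matrix ::
  "(real \<Rightarrow> real^3) \<Rightarrow> (real \<Rightarrow> real^3) \<Rightarrow> (real \<Rightarrow> real^3) \<Rightarrow> (real \<Rightarrow> real^3)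
     \<Rightarrow> real \<Rightarrow> real \<Rightarrow> real^3^3"
where
  "frame_matrix \<nu>1 \<nu>2 \<nu>1' \<nu>2' u v =
     (THE T. rotation_matrix T \<and> moving_frame \<nu>1' \<nu>2' v = T ** moving_frame \<nu>1 \<nu>2 u)"

definition translation_surface ::
  "(real \<Rightarrow> real^3) \<Rightarrow> (real \<Rightarrow> real^3) \<Rightarrow> real \<times> real \<Rightarrow> real^3"
  where "translation_surface \<gamma> \<gamma>' = (\<lambda>(u, v). \<gamma> u + \<gamma>' v)"


subsection \<open>Generalised framed surfaces\<close>

text \<open>
  For open \<open>U\<close> the last condition is automatic, so the open sets satisfying
  \<open>planar_domain\<close> are exactly the nonempty simply connected open sets (connectedness is
  part of \<open>simply_connected\<close>). Products of nondegenerate intervals satisfy it as well,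
  whether or not the intervals contain their endpoints.
\<close>

definition planar_domain :: "(real \<times> real) set \<Rightarrow> bool"
where
  "planar_domain U \<longleftrightarrow>
     U \<noteq> {} \<and> simply_connected U \<and>
     (\<forall>p\<in>U. \<exists>a b. box a b \<noteq> {} \<and> p \<in> cbox a b \<and> cbox a b \<subseteq> U)"

definition partial_u ::
  "(real \<times> real) set \<Rightarrow> (real \<times> real \<Rightarrow> real^3) \<Rightarrow> real \<times> real \<Rightarrow> real^3"
where
  "partial_u U f p =
     vector_derivative (\<lambda>s. f (s, snd p)) (at (fst p) within {s. (s, snd p) \<in> U})"

definition partial_v ::
  "(real \<times> real) set \<Rightarrow> (real \<times> real \<Rightarrow> real^3) \<Rightarrow> real \<times> real \<Rightarrow> real^3"
where
  "partial_v U f p =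
     vector_derivative (\<lambda>t. f (fst p, t)) (at (snd p) within {t. (fst p, t) \<in> U})"

definition gfs_coefficients ::
  "(real \<times> real) set \<Rightarrow> (real \<times> real \<Rightarrow> real^3) \<Rightarrow> (real \<times> real \<Rightarrow> real^3)
     \<Rightarrow> (real \<times> real \<Rightarrow> real^3) \<Rightarrow> (real \<times> real \<Rightarrow> real) \<Rightarrow> (real \<times> real \<Rightarrow> real) \<Rightarrow> bool"
where
  "gfs_coefficients U x N1 N2 A B \<longleftrightarrow>
     smooth_on U A \<and> smooth_on U B \<and>
     (\<forall>p\<in>U. cross3 (partial_u U x p) (partial_v U x p) = A p *\<^sub>R N1 p + B p *\<^sub>R N2 p)"

definition generalised_framed_surface ::
  "(real \<times> real) set \<Rightarrow> (real \<times> real \<Rightarrow> real^3) \<Rightarrow> (real \<times> real \<Rightarrow> real^3)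
     \<Rightarrow> (real \<times> real \<Rightarrow> real^3) \<Rightarrow> bool"
where
  "generalised_framed_surface U x N1 N2 \<longleftrightarrow>
     planar_domain U \<and>
     smooth_on U (\<lambda>p. (x p, N1 p, N2 p)) \<and>
     (\<forall>p\<in>U. (N1 p, N2 p) \<in> Delta) \<and>
     (\<exists>A B. gfs_coefficients U x N1 N2 A B)"

text \<open>The basic invariants as matrices with rows \<open>(a\<^sub>i, b\<^sub>i, c\<^sub>i)\<close> and \<open>(e\<^sub>i, f\<^sub>i, g\<^sub>i)\<close>.\<close>

definition abc_invariants ::
  "(real \<times> real) set \<Rightarrow> (real \<times> real \<Rightarrow> real^3) \<Rightarrow> (real \<times> real \<Rightarrow> real^3)
     \<Rightarrow> (real \<times> real \<Rightarrow> real^3) \<Rightarrow> real \<times> real \<Rightarrow> real^3^2"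
where
  "abc_invariants U x N1 N2 p =
     (let N3 = cross3 (N1 p) (N2 p) in
      vector
       [vector [partial_u U x p \<bullet> N1 p, partial_u U x p \<bullet> N2 p, partial_u U x p \<bullet> N3],
        vector [partial_v U x p \<bullet> N1 p, partial_v U x p \<bullet> N2 p, partial_v U x p \<bullet> N3]])"

definition efg_invariants ::
  "(real \<times> real) set \<Rightarrow> (real \<times> real \<Rightarrow> real^3) \<Rightarrow> (real \<times> real \<Rightarrow> real^3)
     \<Rightarrow> real \<times> real \<Rightarrow> real^3^2"
where
  "efg_invariants U N1 N2 p =
     (let N3 = cross3 (N1 p) (N2 p) in
      vector
       [vector [partial_u U N1 p \<bullet> N2 p, partial_u U N1 p \<bullet> N3, partial_u U N2 p \<bullet> N3],
        vector [partial_v U N1 p \<bullet> N2 p, partial_v U N1 p \<bullet> N3, partial_v U N2 p \<bullet> N3]])"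

end

theory Submission
  imports Defs
begin

text \<open>
  In an orthonormal frame every vector is the sum of its components along the frame, so
  \<open>\<gamma>\<^sub>u = \<alpha> \<mu>\<close> for a framed curve, and the entries of the frame matrix are the inner products
  of the vectors of the two frames. The invariants are then read off from \<open>x\<^sub>u = \<alpha> \<mu>\<close> and
  \<open>x\<^sub>v = \<alpha>' \<mu>'\<close>, and \<open>A\<close>, \<open>B\<close> from expanding \<open>\<mu>'\<close> in the frame of \<open>\<gamma>\<close> (respectively
  \<open>\<mu>\<close> in the frame of \<open>\<gamma>'\<close>) inside \<open>\<mu> \<times> \<mu>'\<close>.
\<close>

subsection \<open>Smooth maps on sets with unique derivatives\<close>

text \<open>Accumulation at each point of the set along every coordinate axis is what forces a
  derivative within the set to be unique. Since \<open>d\<close> may have either sign, one-sided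
  approach at boundary points suffices.\<close>

definition thick :: "'a::euclidean_space set \<Rightarrow> bool"
  where "thick S \<longleftrightarrow>
    (\<forall>x\<in>S. \<forall>i\<in>Basis. \<forall>e>0. \<exists>d. 0 < \<bar>d\<bar> \<and> \<bar>d\<bar> < e \<and> x + d *\<^sub>R i \<in> S)"

lemma thick_frechet_derivative:
  assumes "thick S" "x \<in> S" "(f has_derivative f') (at x within S)"
  shows "frechet_derivative f (at x within S) = f'"
proof (rule frechet_derivative_unique_within)
  show "(f has_derivative frechet_derivative f (at x within S)) (at x within S)"
    using assms(3) differentiableI frechet_derivative_works by blast
qed (use assms in \<open>auto simp: thick_def\<close>)

lemma interval_obtain_other:
  fixes I :: "real set"
  assumes "interior I \<noteq> {}"
  obtains w where "w \<in> I" "w \<noteq> x"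
proof -
  obtain y e where "e > 0" "ball y e \<subseteq> I"
    using assms by (auto simp: mem_interior)
  then have "y \<in> I" "y + e / 2 \<in> I" "y \<noteq> y + e / 2"
    by (auto simp: subset_iff dist_real_def)
  then show thesis
    using that by metis
qed

lemma thick_interval:
  fixes I :: "real set"
  assumes "is_interval I" "interior I \<noteq> {}"
  shows "thick I"
  unfolding thick_def
proof (intro ballI allI impI)
  fix x i e :: real
  assume x: "x \<in> I" and i: "i \<in> Basis" and e: "e > 0"
  obtain w where w: "w \<in> I" "w \<noteq> x"
    using interval_obtain_other[OF assms(2)] .
  \<comment> \<open>The point at parameter \<open>t\<close> on the segment from \<open>x\<close> to
    \<open>w\<close> is at distance at most \<open>e / 2\<close> from \<open>x\<close>; the bound 1
    keeps it on the segment.\<close>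
  define t where "t = min 1 (e / 2 / \<bar>w - x\<bar>)"
  have t: "0 < t" "t \<le> 1" "t * \<bar>w - x\<bar> \<le> e / 2"
    using w e by (auto simp: t_def min_def field_simps)
  have "(1 - t) *\<^sub>R x + t *\<^sub>R w \<in> I"
    using t x w assms(1) by (intro convexD_alt) (auto simp: is_interval_convex)
  moreover have "(1 - t) *\<^sub>R x + t *\<^sub>R w = x + (t * (w - x)) *\<^sub>R i"
    using i by (simp add: algebra_simps)
  ultimately show "\<exists>d. 0 < \<bar>d\<bar> \<and> \<bar>d\<bar> < e \<and> x + d *\<^sub>R i \<in> I"
    using t e w by (intro exI[of _ "t * (w - x)"]) (auto simp: abs_mult)
qed

text \<open>A basis vector of a product moves only one factor, so the displacement found in that
  factor serves for the product.\<close>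

lemma thick_Times:
  assumes "thick S" "thick R"
  shows "thick (S \<times> R)"
  unfolding thick_def
proof (intro ballI allI impI)
  fix p and i :: "'a \<times> 'b" and e :: real
  assume p: "p \<in> S \<times> R" and i: "i \<in> Basis" and e: "e > 0"
  consider j where "j \<in> Basis" "i = (j, 0)" | j where "j \<in> Basis" "i = (0, j)"
    using i by (auto simp: Basis_prod_def)
  then show "\<exists>d. 0 < \<bar>d\<bar> \<and> \<bar>d\<bar> < e \<and> p + d *\<^sub>R i \<in> S \<times> R"
  proof cases
    case (1 j)
    then obtain d where "0 < \<bar>d\<bar>" "\<bar>d\<bar> < e" "fst p + d *\<^sub>R j \<in> S"
      using assms(1) p e unfolding thick_def by (metis mem_Times_iff)
    then show ?thesis
      using p 1 by (intro exI[of _ d]) (auto simp: mem_Times_iff)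
  next
    case (2 j)
    then obtain d where "0 < \<bar>d\<bar>" "\<bar>d\<bar> < e" "snd p + d *\<^sub>R j \<in> R"
      using assms(2) p e unfolding thick_def by (metis mem_Times_iff)
    then show ?thesis
      using p 2 by (intro exI[of _ d]) (auto simp: mem_Times_iff)
  qed
qed

lemma at_within_thick_neq_bot:
  fixes S :: "real set"
  assumes "thick S" "x \<in> S"
  shows "at x within S \<noteq> bot"
proof -
  have "x islimpt S"
    unfolding islimpt_approachable_real
  proof (intro allI impI)
    fix e :: real
    assume "e > 0"
    then obtain d where "0 < \<bar>d\<bar>" "\<bar>d\<bar> < e" "x + d \<in> S"
      using assms unfolding thick_def by (metis Basis_real_def insertI1 mult.right_neutral real_scaleR_def)
    then show "\<exists>y\<in>S. y \<noteq> x \<and> \<bar>y - x\<bar> < e"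
      by (intro bexI[of _ "x + d"]) auto
  qed
  then show ?thesis
    by (simp add: trivial_limit_within)
qed

section \<open>Calculus of maps of class \<open>Ck_on\<close>\<close>

lemma Ck_on_has_derivative:
  assumes "Ck_on (Suc k) S f" "x \<in> S"
  shows "(f has_derivative frechet_derivative f (at x within S)) (at x within S)"
  using assms by (auto simp: differentiable_on_def frechet_derivative_works)

lemma frechet_derivative_within_cong:
  assumes "x \<in> S" "\<And>x. x \<in> S \<Longrightarrow> f x = g x"
  shows "frechet_derivative f (at x within S) = frechet_derivative g (at x within S)"
proof -
  \<comment> \<open>\<open>frechet_derivative\<close> is a choice from the predicate
    \<open>has_derivative\<close>. At a point of \<open>S\<close> this predicate is the same for
    both maps, hence so is the choice.\<close>
  have "(f has_derivative F) (at x within S) \<longleftrightarrow> (g has_derivative F) (at x within S)" for F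
    using has_derivative_transform[OF assms(1), of f g F]
      has_derivative_transform[OF assms(1), of g f F] assms(2) by auto
  then show ?thesis
    by (simp add: frechet_derivative_def)
qed

text \<open>Derivatives within \<open>S\<close> see only values on \<open>S\<close>. This lets
  smoothness pass to functions such as \<open>\<alpha>\<close> or \<open>T\<close>, which are
  specified only on the domain.\<close>

lemma Ck_on_cong:
  assumes "\<And>x. x \<in> S \<Longrightarrow> f x = g x" "Ck_on k S f"
  shows "Ck_on k S g"
  using assms
proof (induction k arbitrary: f g)
  case 0
  then show ?case
    using continuous_on_cong[of S S f g] by simp
next
  case (Suc k)
  have "(g has_derivative frechet_derivative f (at x within S)) (at x within S)" if "x \<in> S" for x
    using that Suc.prems(1)
    by (intro has_derivative_transform[OF that _ Ck_on_has_derivative[OF Suc.prems(2) that]]) simp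
  then have "g differentiable_on S"
    unfolding differentiable_on_def using differentiableI by blast
  moreover have "Ck_on k S (\<lambda>x. frechet_derivative g (at x within S) h)" for h
  proof (rule Suc.IH)
    show "Ck_on k S (\<lambda>x. frechet_derivative f (at x within S) h)"
      using Suc.prems(2) by simp
    show "frechet_derivative f (at x within S) h = frechet_derivative g (at x within S) h"
      if "x \<in> S" for x
      using frechet_derivative_within_cong[OF that Suc.prems(1)] by simp
  qed
  ultimately show ?case
    by simp
qed

text \<open>Any derivative \<open>F\<close> produced by the differentiation rules may stand in for
  the chosen one, because thickness makes the two agree. The closure properties below are inductions
  on \<open>k\<close> through this rule.\<close>

lemma Ck_on_SucI:
  assumes "thick S" "\<And>x. x \<in> S \<Longrightarrow> (f has_derivative F x) (at x within S)"
    and "\<And>h. Ck_on k S (\<lambda>x. F x h)"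
  shows "Ck_on (Suc k) S f"
proof -
  have "f differentiable_on S"
    using assms(2) by (auto simp: differentiable_on_def differentiable_def)
  moreover have "Ck_on k S (\<lambda>x. frechet_derivative f (at x within S) h)" for h
    by (rule Ck_on_cong[OF _ assms(3)[of h]]) (simp add: thick_frechet_derivative[OF assms(1) _ assms(2)])
  ultimately show ?thesis
    by simp
qed

lemma Ck_on_Suc_imp: "Ck_on (Suc k) S f \<Longrightarrow> Ck_on k S f"
  by (induction k arbitrary: f) (auto intro: differentiable_imp_continuous_on)

lemma Ck_on_bounded_linear:
  assumes "thick S" "bounded_linear L" "Ck_on k S f"
  shows "Ck_on k S (\<lambda>x. L (f x))"
  using assms(3)
proof (induction k arbitrary: f)
  case 0
  then show ?case
    by (auto intro: bounded_linear.continuous_on[OF assms(2)])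
next
  case (Suc k)
  show ?case
    by (rule Ck_on_SucI[OF assms(1)
          bounded_linear.has_derivative[OF assms(2) Ck_on_has_derivative[OF Suc.prems]]])
      (use Suc in auto)
qed

lemma Ck_on_add:
  assumes "thick S" "Ck_on k S f" "Ck_on k S g"
  shows "Ck_on k S (\<lambda>x. f x + g x)"
  using assms(2,3)
proof (induction k arbitrary: f g)
  case 0
  then show ?case
    by (auto intro: continuous_on_add)
next
  case (Suc k)
  show ?case
    by (rule Ck_on_SucI[OF assms(1) has_derivative_add[OF Ck_on_has_derivative[OF Suc.prems(1)]
            Ck_on_has_derivative[OF Suc.prems(2)]]])
      (use Suc in auto)
qed

lemma Ck_on_bounded_bilinear:
  assumes "thick S" "bounded_bilinear B" "Ck_on k S f" "Ck_on k S g"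
  shows "Ck_on k S (\<lambda>x. B (f x) (g x))"
  using assms(3,4)
proof (induction k arbitrary: f g)
  case 0
  then show ?case
    by (auto intro: bounded_bilinear.continuous_on[OF assms(2)])
next
  case (Suc k)
  show ?case
  proof (rule Ck_on_SucI[OF assms(1) bounded_bilinear.FDERIV[OF assms(2)
          Ck_on_has_derivative[OF Suc.prems(1)] Ck_on_has_derivative[OF Suc.prems(2)]]])
    fix h
    show "Ck_on k S (\<lambda>x. B (f x) (frechet_derivative g (at x within S) h)
        + B (frechet_derivative f (at x within S) h) (g x))"
      \<comment> \<open>The product rule pairs a derivative of order \<open>k\<close> with an
        undifferentiated factor of order \<open>Suc k\<close>, which must first be lowered to order
        \<open>k\<close>.\<close>
      using Suc.prems Suc.prems[THEN Ck_on_Suc_imp]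
      by (intro Ck_on_add[OF assms(1)] Suc.IH) simp_all
  qed auto
qed

text \<open>For linear \<open>P\<close> the chain rule gives the derivative of \<open>f\<close> at
  \<open>P x\<close> in the direction \<open>P h\<close>, which is independent of \<open>x\<close>.
  The derivative is thus again a map composed with \<open>P\<close>, and the induction closes. The
  intended \<open>P\<close> are the projections of a product.\<close>

lemma Ck_on_compose_bounded_linear:
  assumes "thick S" "bounded_linear P" "P ` S \<subseteq> R" "Ck_on k R f"
  shows "Ck_on k S (\<lambda>x. f (P x))"
  using assms(4)
proof (induction k arbitrary: f)
  case 0
  then show ?case
    using assms(3) linear_continuous_on[OF assms(2)]
    by (auto intro: continuous_on_compose2)
next
  case (Suc k)
  show ?case
  proof (rule Ck_on_SucI[OF assms(1)
        has_derivative_in_compose2[OF Ck_on_has_derivative[OF Suc.prems] assms(3) _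
          bounded_linear.has_derivative[OF assms(2) has_derivative_ident]]])
    fix h
    show "Ck_on k S (\<lambda>x. frechet_derivative f (at (P x) within R) (P h))"
      using Suc.prems by (intro Suc.IH[of "\<lambda>y. frechet_derivative f (at y within R) (P h)"]) simp
  qed auto
qed

section \<open>Closure properties of smooth maps\<close>

lemma smooth_on_cong:
  "smooth_on S f \<Longrightarrow> (\<And>x. x \<in> S \<Longrightarrow> f x = g x) \<Longrightarrow> smooth_on S g"
  unfolding smooth_on_def using Ck_on_cong by blast

lemma smooth_on_bounded_linear:
  "bounded_linear L \<Longrightarrow> thick S \<Longrightarrow> smooth_on S f \<Longrightarrow> smooth_on S (\<lambda>x. L (f x))"
  unfolding smooth_on_def using Ck_on_bounded_linear by blast

lemma smooth_on_add:
  "thick S \<Longrightarrow> smooth_on S f \<Longrightarrow> smooth_on S g \<Longrightarrow> smooth_on S (\<lambda>x. f x + g x)"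
  unfolding smooth_on_def using Ck_on_add by blast

lemma smooth_on_bounded_bilinear:
  "bounded_bilinear B \<Longrightarrow> thick S \<Longrightarrow> smooth_on S f \<Longrightarrow> smooth_on S g
    \<Longrightarrow> smooth_on S (\<lambda>x. B (f x) (g x))"
  unfolding smooth_on_def using Ck_on_bounded_bilinear by blast

lemma smooth_on_compose_bounded_linear:
  "bounded_linear P \<Longrightarrow> P ` S \<subseteq> R \<Longrightarrow> thick S \<Longrightarrow> smooth_on R f
    \<Longrightarrow> smooth_on S (\<lambda>x. f (P x))"
  unfolding smooth_on_def using Ck_on_compose_bounded_linear by blast

lemmas smooth_on_fst = smooth_on_bounded_linear[OF bounded_linear_fst]
lemmas smooth_on_snd = smooth_on_bounded_linear[OF bounded_linear_snd]
lemmas smooth_on_minus = smooth_on_bounded_linear[OF bounded_linear_minus[OF bounded_linear_ident]]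
lemmas smooth_on_mult = smooth_on_bounded_bilinear[OF bounded_bilinear_mult]
lemmas smooth_on_inner = smooth_on_bounded_bilinear[OF bounded_bilinear_inner]
lemmas smooth_on_cross3 =
  smooth_on_bounded_bilinear[OF bilinear_cross[unfolded bilinear_conv_bounded_bilinear]]

lemma smooth_on_compose_fst:
  "thick (S \<times> R) \<Longrightarrow> smooth_on S f \<Longrightarrow> smooth_on (S \<times> R) (\<lambda>p. f (fst p))"
  by (rule smooth_on_compose_bounded_linear[OF bounded_linear_fst]) auto

lemma smooth_on_compose_snd:
  "thick (S \<times> R) \<Longrightarrow> smooth_on R f \<Longrightarrow> smooth_on (S \<times> R) (\<lambda>p. f (snd p))"
  by (rule smooth_on_compose_bounded_linear[OF bounded_linear_snd]) auto

lemma smooth_on_Pair: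
  assumes "thick S" "smooth_on S f" "smooth_on S g"
  shows "smooth_on S (\<lambda>x. (f x, g x))"
proof -
  \<comment> \<open>A pair is the sum of its images under the two linear embeddings of the factors,
    so the rules for sums and linear maps apply.\<close>
  have "smooth_on S (\<lambda>x. (f x, 0) + (0, g x))"
    using assms
    by (intro smooth_on_add smooth_on_bounded_linear[where L = "\<lambda>y. (y, 0)"]
        smooth_on_bounded_linear[where L = "\<lambda>y. (0, y)"] bounded_linear_Pair
        bounded_linear_ident bounded_linear_zero)
  then show ?thesis
    by simp
qed

text \<open>The vector derivative is the Frechet derivative in the direction 1, whose smoothness is
  built into \<open>Ck_on\<close>, one order down.\<close>

lemma smooth_on_vector_derivative:
  fixes f :: "real \<Rightarrow> 'b::real_normed_vector"
  assumes "thick S" "smooth_on S f"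
  shows "smooth_on S (\<lambda>x. vector_derivative f (at x within S))"
proof -
  have f: "Ck_on (Suc k) S f" for k
    using assms(2) by (simp add: smooth_on_def del: Ck_on.simps)
  have *: "(f has_vector_derivative vector_derivative f (at x within S)) (at x within S)"
    if "x \<in> S" for x
    using f[of 0] that by (auto simp: differentiable_on_def simp flip: vector_derivative_works)
  have "smooth_on S (\<lambda>x. frechet_derivative f (at x within S) 1)"
    using f by (simp add: smooth_on_def)
  then show ?thesis
    by (rule smooth_on_cong)
      (simp add: thick_frechet_derivative[OF assms(1) _ *[unfolded has_vector_derivative_def]])
qed

subsection \<open>Orthonormal frames\<close>

text \<open>The multiplication table of a right-handed orthonormal frame. The cross products come
  from the triple product formula \<open>Lagrange\<close>, the remaining ones by skew
  symmetry.\<close>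

lemma Delta_frame:
  assumes "(a, b) \<in> Delta"
  shows "a \<bullet> a = 1" "b \<bullet> b = 1" "a \<bullet> b = 0" "b \<bullet> a = 0" "cross3 a b \<bullet> cross3 a b = 1"
    "cross3 b (cross3 a b) = a" "cross3 (cross3 a b) a = b"
    "cross3 (cross3 a b) b = - a" "cross3 a (cross3 a b) = - b"
proof -
  show *: "a \<bullet> a = 1" "b \<bullet> b = 1" "a \<bullet> b = 0" "b \<bullet> a = 0"
    using assms by (auto simp: Delta_def norm_eq_1 inner_commute)
  then show "cross3 a b \<bullet> cross3 a b = 1"
    by (simp add: dot_cross)
  show **: "cross3 b (cross3 a b) = a" "cross3 a (cross3 a b) = - b"
    using * by (simp_all add: Lagrange)
  then show "cross3 (cross3 a b) a = b" "cross3 (cross3 a b) b = - a"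
    using cross_skew[of "cross3 a b" a] cross_skew[of "cross3 a b" b] by simp_all
qed

text \<open>The product of the matrix with its transpose is the Gram matrix of the frame, and its
  determinant is the triple product of the rows, which reduces to
  \<open>\<nu>1 u \<bullet> \<nu>1 u\<close>.\<close>

lemma rotation_matrix_moving_frame:
  assumes "(\<nu>1 u, \<nu>2 u) \<in> Delta"
  shows "rotation_matrix (moving_frame \<nu>1 \<nu>2 u)"
proof -
  let ?F = "moving_frame \<nu>1 \<nu>2 u"
  have "(?F ** transpose ?F) $ i $ j = ?F $ i \<bullet> ?F $ j" for i j
    by (simp add: matrix_matrix_mult_def transpose_def inner_vec_def)
  then have "?F ** transpose ?F = mat 1"
    using Delta_frame[OF assms]
    by (simp add: vec_eq_iff forall_3 moving_frame_def frame_normal_def mat_def dot_cross_self)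
  moreover have "det ?F = 1"
    using Delta_frame[OF assms]
    by (simp add: moving_frame_def frame_normal_def flip: dot_cross_det)
  ultimately show ?thesis
    by (simp add: rotation_matrix_def orthogonal_matrix_def matrix_left_right_inverse)
qed

text \<open>With \<mu> the cross product of \<open>a\<close> and \<open>b\<close>, compute \<mu>
  \<times> (w \<times> \<mu>) in two ways. The triple product formula gives \<open>w\<close> minus
  its component along \<mu>; expanding the inner product first gives the components along
  \<open>a\<close> and \<open>b\<close>.\<close>

lemma frame_expansion:
  assumes "(a, b) \<in> Delta"
  shows "w = (w \<bullet> a) *\<^sub>R a + (w \<bullet> b) *\<^sub>R b + (w \<bullet> cross3 a b) *\<^sub>R (cross3 a b)"
proof -
  have "cross3 (cross3 a b) (cross3 w (cross3 a b)) = w - (w \<bullet> cross3 a b) *\<^sub>R (cross3 a b)"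
    using Delta_frame[OF assms] Lagrange[of "cross3 a b" w "cross3 a b"]
    by (simp add: inner_commute)
  moreover have "cross3 w (cross3 a b) = (w \<bullet> b) *\<^sub>R a - (w \<bullet> a) *\<^sub>R b"
    by (simp add: Lagrange)
  ultimately show ?thesis
    using Delta_frame[OF assms]
    by (simp add: Cross3.right_diff_distrib cross_mult_right algebra_simps)
qed

text \<open>Orthogonality of the frame at \<open>u\<close> allows solving for \<open>T\<close> by
  multiplying with the transpose on the right. The solution is a rotation and the only one, which
  resolves the definite description.\<close>

lemma frame_matrix_eq:
  assumes "(\<nu>1 u, \<nu>2 u) \<in> Delta" "(\<nu>1' v, \<nu>2' v) \<in> Delta"
  shows "frame_matrix \<nu>1 \<nu>2 \<nu>1' \<nu>2' u v
    = moving_frame \<nu>1' \<nu>2' v ** transpose (moving_frame \<nu>1 \<nu>2 u)"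
proof -
  let ?F = "moving_frame \<nu>1 \<nu>2 u" and ?F' = "moving_frame \<nu>1' \<nu>2' v"
  have F: "rotation_matrix ?F" "rotation_matrix ?F'"
    using assms by (simp_all add: rotation_matrix_moving_frame)
  then have inv: "transpose ?F ** ?F = mat 1" "?F ** transpose ?F = mat 1"
    by (simp_all add: rotation_matrix_def orthogonal_matrix_def)
  show ?thesis
    unfolding frame_matrix_def
  proof (rule the_equality)
    show "rotation_matrix (?F' ** transpose ?F) \<and> ?F' = (?F' ** transpose ?F) ** ?F"
      using F inv
      by (simp add: rotation_matrix_def orthogonal_matrix_mul orthogonal_matrix_transpose det_mul
          flip: matrix_mul_assoc)
  next
    fix T
    assume "rotation_matrix T \<and> ?F' = T ** ?F"
    then show "T = ?F' ** transpose ?F"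
      using inv by (simp flip: matrix_mul_assoc)
  qed
qed

lemma frame_matrix_nth:
  assumes "(\<nu>1 u, \<nu>2 u) \<in> Delta" "(\<nu>1' v, \<nu>2' v) \<in> Delta"
  shows "frame_matrix \<nu>1 \<nu>2 \<nu>1' \<nu>2' u v $ i $ j
    = moving_frame \<nu>1' \<nu>2' v $ i \<bullet> moving_frame \<nu>1 \<nu>2 u $ j"
  using frame_matrix_eq[of \<nu>1 u \<nu>2 \<nu>1' v \<nu>2'] assms
  by (simp add: matrix_matrix_mult_def transpose_def inner_vec_def)

section \<open>Framed curves: velocity and smoothness\<close>

lemma framed_curve_Delta:
  "framed_curve I \<gamma> \<nu>1 \<nu>2 \<Longrightarrow> u \<in> I \<Longrightarrow> (\<nu>1 u, \<nu>2 u) \<in> Delta"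
  by (simp add: framed_curve_def)

lemma framed_curve_velocity:
  assumes "framed_curve I \<gamma> \<nu>1 \<nu>2" "curvature I \<gamma> \<nu>1 \<nu>2 u = (l, m, n, \<alpha>)" "u \<in> I"
  shows "vector_derivative \<gamma> (at u within I) = \<alpha> *\<^sub>R (cross3 (\<nu>1 u) (\<nu>2 u))"
  using assms frame_expansion[of "\<nu>1 u" "\<nu>2 u" "vector_derivative \<gamma> (at u within I)"]
  by (simp add: framed_curve_def curvature_def frame_normal_def)

lemma framed_curve_smooth:
  assumes "framed_curve I \<gamma> \<nu>1 \<nu>2" "thick I"
  shows "smooth_on I \<gamma>" "smooth_on I \<nu>1" "smooth_on I \<nu>2"
proof -
  have *: "smooth_on I (\<lambda>u. (\<gamma> u, \<nu>1 u, \<nu>2 u))"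
    using assms(1) by (simp add: framed_curve_def)
  show "smooth_on I \<gamma>"
    using smooth_on_fst[OF assms(2) *] by simp
  show "smooth_on I \<nu>1"
    using smooth_on_fst[OF assms(2) smooth_on_snd[OF assms(2) *]] by simp
  show "smooth_on I \<nu>2"
    using smooth_on_snd[OF assms(2) smooth_on_snd[OF assms(2) *]] by simp
qed

text \<open>On \<open>I\<close> the function \<open>\<alpha>\<close> is an inner product of smooth
  maps; its smoothness is needed for that of the coefficients \<open>A\<close> and
  \<open>B\<close>.\<close>

lemma framed_curve_smooth_speed:
  assumes "framed_curve I \<gamma> \<nu>1 \<nu>2" "thick I"
    and "\<And>u. u \<in> I \<Longrightarrow> curvature I \<gamma> \<nu>1 \<nu>2 u = (l u, m u, n u, \<alpha> u)"
  shows "smooth_on I \<alpha>"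
proof -
  note smooth = framed_curve_smooth[OF assms(1,2)]
  have "smooth_on I (\<lambda>u. vector_derivative \<gamma> (at u within I) \<bullet> cross3 (\<nu>1 u) (\<nu>2 u))"
    by (intro smooth_on_inner smooth_on_cross3 smooth_on_vector_derivative smooth assms(2))
  then show ?thesis
    by (rule smooth_on_cong) (use assms(3) in \<open>simp add: curvature_def frame_normal_def\<close>)
qed

subsection \<open>Translation surfaces\<close>

text \<open>Simple connectedness follows from convexity, and the surrounding boxes are products of
  one-dimensional ones.\<close>

lemma planar_domain_Times:
  fixes I J :: "real set"
  assumes "is_interval I" "interior I \<noteq> {}" "is_interval J" "interior J \<noteq> {}"
  shows "planar_domain (I \<times> J)"
proof -
  \<comment> \<open>The closed interval between \<open>u\<close> and a second point \<open>w\<close>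
    of \<open>K\<close> will do, so \<open>u\<close> may be an endpoint of \<open>K\<close>.\<close>
  have *: "\<exists>a b. a < b \<and> u \<in> {a..b} \<and> {a..b} \<subseteq> K"
    if "is_interval K" "interior K \<noteq> {}" "u \<in> K" for K and u :: real
  proof -
    obtain w where w: "w \<in> K" "w \<noteq> u"
      using interval_obtain_other[OF \<open>interior K \<noteq> {}\<close>] .
    have "min u w \<in> K" "max u w \<in> K"
      using \<open>u \<in> K\<close> w(1) by (simp_all add: min_def max_def)
    then have "s \<in> K" if "s \<in> {min u w..max u w}" for s
      using that mem_is_interval_1_I[OF \<open>is_interval K\<close>, of "min u w" "max u w" s] by simp
    then have "{min u w..max u w} \<subseteq> K" ..
    then show ?thesis
      using w(2) by (intro exI[of _ "min u w"] exI[of _ "max u w"]) auto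
  qed
  have "\<exists>a b. box a b \<noteq> {} \<and> p \<in> cbox a b \<and> cbox a b \<subseteq> I \<times> J" if p: "p \<in> I \<times> J" for p
  proof -
    obtain a b where I: "a < b" "fst p \<in> {a..b}" "{a..b} \<subseteq> I"
      using *[OF assms(1,2), of "fst p"] p by auto
    obtain c d where J: "c < d" "snd p \<in> {c..d}" "{c..d} \<subseteq> J"
      using *[OF assms(3,4), of "snd p"] p by auto
    have "box (a, c) (b, d) \<noteq> {}"
      using I(1) J(1) by (auto simp: box_ne_empty Basis_prod_def)
    moreover have "p \<in> cbox (a, c) (b, d)" "cbox (a, c) (b, d) \<subseteq> I \<times> J"
      using I(2,3) J(2,3) by (cases p; auto simp: cbox_Pair_eq)+
    ultimately show ?thesis
      by blast
  qed
  moreover have "I \<times> J \<noteq> {}"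
    using assms(2,4) interior_subset by fastforce
  moreover have "simply_connected (I \<times> J)"
    using assms by (intro convex_imp_simply_connected convex_Times is_interval_convex)
  ultimately show ?thesis
    by (simp add: planar_domain_def)
qed

section \<open>Partial derivatives on a product of intervals\<close>

lemma partial_Times_fst:
  assumes "thick J" "v \<in> J" "u \<in> I"
  shows "partial_u (I \<times> J) (\<lambda>(u, v). f u) (u, v) = vector_derivative f (at u within I)"
    and "partial_v (I \<times> J) (\<lambda>(u, v). f u) (u, v) = 0"
  \<comment> \<open>The slices of the product are \<open>I\<close> and \<open>J\<close>. Along the
    slice on which the map is constant, thickness makes 0 the unique derivative.\<close>
  using assms by (simp_all add: partial_u_def partial_v_def
      vector_derivative_within[OF at_within_thick_neq_bot has_vector_derivative_const])

lemma partial_Times_snd: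
  assumes "thick I" "u \<in> I" "v \<in> J"
  shows "partial_u (I \<times> J) (\<lambda>(u, v). f v) (u, v) = 0"
    and "partial_v (I \<times> J) (\<lambda>(u, v). f v) (u, v) = vector_derivative f (at v within J)"
  using assms by (simp_all add: partial_u_def partial_v_def
      vector_derivative_within[OF at_within_thick_neq_bot has_vector_derivative_const])

lemma partial_translation_surface:
  assumes "u \<in> I" "v \<in> J"
  shows "partial_u (I \<times> J) (translation_surface \<gamma> \<gamma>') (u, v) = vector_derivative \<gamma> (at u within I)"
    and "partial_v (I \<times> J) (translation_surface \<gamma> \<gamma>') (u, v) = vector_derivative \<gamma>' (at v within J)"
proof -
  \<comment> \<open>With one parameter fixed, the surface is a curve followed by a translation,
    which leaves the vector derivative unchanged.\<close>
  have "(\<lambda>s. \<gamma> s + \<gamma>' v) = (+) (\<gamma>' v) \<circ> \<gamma>" "(\<lambda>t. \<gamma> u + \<gamma>' t) = (+) (\<gamma> u) \<circ> \<gamma>'"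
    by (simp_all add: fun_eq_iff)
  then show "partial_u (I \<times> J) (translation_surface \<gamma> \<gamma>') (u, v) = vector_derivative \<gamma> (at u within I)"
    "partial_v (I \<times> J) (translation_surface \<gamma> \<gamma>') (u, v) = vector_derivative \<gamma>' (at v within J)"
    using assms by (simp_all add: partial_u_def partial_v_def translation_surface_def)
qed

theorem proposition2p4:
  fixes I J :: "real set"
    and \<gamma> \<nu>1 \<nu>2 \<gamma>' \<nu>1' \<nu>2' :: "real \<Rightarrow> real^3"
    and l m n \<alpha> l' m' n' \<alpha>' :: "real \<Rightarrow> real"
    and T :: "real \<Rightarrow> real \<Rightarrow> real^3^3"
    and x :: "real \<times> real \<Rightarrow> real^3"
  assumes "is_interval I" "interior I \<noteq> {}"
    and "is_interval J" "interior J \<noteq> {}"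
    and "framed_curve I \<gamma> \<nu>1 \<nu>2"
    and "framed_curve J \<gamma>' \<nu>1' \<nu>2'"
    and "\<And>u. u \<in> I \<Longrightarrow> curvature I \<gamma> \<nu>1 \<nu>2 u = (l u, m u, n u, \<alpha> u)"
    and "\<And>v. v \<in> J \<Longrightarrow> curvature J \<gamma>' \<nu>1' \<nu>2' v = (l' v, m' v, n' v, \<alpha>' v)"
    and "\<And>u v. u \<in> I \<Longrightarrow> v \<in> J \<Longrightarrow> T u v = frame_matrix \<nu>1 \<nu>2 \<nu>1' \<nu>2' u v"
    and "x = translation_surface \<gamma> \<gamma>'"
  shows
    "(let N1 = (\<lambda>(u, v). \<nu>1 u); N2 = (\<lambda>(u, v). \<nu>2 u) in
       generalised_framed_surface (I \<times> J) x N1 N2 \<and>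
       (\<forall>u\<in>I. \<forall>v\<in>J.
          abc_invariants (I \<times> J) x N1 N2 (u, v) =
            vector [vector [0, 0, \<alpha> u],
                    vector [\<alpha>' v * T u v $ 3 $ 1, \<alpha>' v * T u v $ 3 $ 2, \<alpha>' v * T u v $ 3 $ 3]] \<and>
          efg_invariants (I \<times> J) N1 N2 (u, v) =
            vector [vector [l u, m u, n u],
                    vector [0, 0, 0]]) \<and>
       gfs_coefficients (I \<times> J) x N1 N2
         (\<lambda>(u, v). - \<alpha> u * \<alpha>' v * T u v $ 3 $ 2)
         (\<lambda>(u, v). \<alpha> u * \<alpha>' v * T u v $ 3 $ 1))
     \<and>
     (let N1 = (\<lambda>(u, v). \<nu>1' v); N2 = (\<lambda>(u, v). \<nu>2' v) in
       generalised_framed_surface (I \<times> J) x N1 N2 \<and>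
       (\<forall>u\<in>I. \<forall>v\<in>J.
          abc_invariants (I \<times> J) x N1 N2 (u, v) =
            vector [vector [\<alpha> u * T u v $ 1 $ 3, \<alpha> u * T u v $ 2 $ 3, \<alpha> u * T u v $ 3 $ 3],
                    vector [0, 0, \<alpha>' v]] \<and>
          efg_invariants (I \<times> J) N1 N2 (u, v) =
            vector [vector [0, 0, 0],
                    vector [l' v, m' v, n' v]]) \<and>
       gfs_coefficients (I \<times> J) x N1 N2
         (\<lambda>(u, v). \<alpha> u * \<alpha>' v * T u v $ 2 $ 3)
         (\<lambda>(u, v). - \<alpha> u * \<alpha>' v * T u v $ 1 $ 3))"
proof -
  have tI: "thick I" and tJ: "thick J"
    using assms by (simp_all add: thick_interval)
  then have t: "thick (I \<times> J)"
    by (rule thick_Times)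
  have dom: "planar_domain (I \<times> J)"
    using assms by (intro planar_domain_Times)
  note fr = framed_curve_Delta[OF assms(5)] and fr' = framed_curve_Delta[OF assms(6)]
  note vel = framed_curve_velocity[OF assms(5) assms(7)]
    and vel' = framed_curve_velocity[OF assms(6) assms(8)]
  note sm = framed_curve_smooth[OF assms(5) tI] framed_curve_smooth_speed[OF assms(5) tI assms(7)]
    and sm' = framed_curve_smooth[OF assms(6) tJ] framed_curve_smooth_speed[OF assms(6) tJ assms(8)]
  note sm_fst = smooth_on_compose_fst[OF t] and sm_snd = smooth_on_compose_snd[OF t]
  have T: "T u v $ i $ j = moving_frame \<nu>1' \<nu>2' v $ i \<bullet> moving_frame \<nu>1 \<nu>2 u $ j"
    if "u \<in> I" "v \<in> J" for u v i j
    using that assms(9) fr fr' frame_matrix_nth[of \<nu>1 u \<nu>2 \<nu>1' v \<nu>2'] by simp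
  note T_simps = T moving_frame_def frame_normal_def
  \<comment> \<open>On the rectangle each entry of \<open>T\<close> is the inner product of a frame
    vector depending on \<open>v\<close> with one depending on \<open>u\<close>, and frame vectors
    are smooth.\<close>
  have sm_T: "smooth_on (I \<times> J) (\<lambda>p. T (fst p) (snd p) $ i $ j)" for i j
  proof -
    have row: "smooth_on K (\<lambda>u. moving_frame \<eta>1 \<eta>2 u $ k)"
      if "thick K" "smooth_on K \<eta>1" "smooth_on K \<eta>2" for K \<eta>1 \<eta>2 and k :: 3
      using that exhaust_3[of k]
      by (auto simp: moving_frame_def frame_normal_def intro: smooth_on_cross3)
    show ?thesis
      by (rule smooth_on_cong[OF smooth_on_inner[OF t
              sm_snd[OF row[OF tJ sm'(2,3)]] sm_fst[OF row[OF tI sm(2,3)]]]])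
        (auto simp: T)
  qed
  have sm_coeff: "smooth_on (I \<times> J) (\<lambda>(u, v). \<alpha> u * \<alpha>' v * T u v $ i $ j)" for i j
    unfolding case_prod_unfold by (intro smooth_on_mult sm_fst sm_snd sm sm' sm_T t)
  have sm_neg_coeff: "smooth_on (I \<times> J) (\<lambda>(u, v). - \<alpha> u * \<alpha>' v * T u v $ i $ j)" for i j
    using smooth_on_minus[OF t sm_coeff[of i j]] by (simp add: case_prod_unfold)
  have sm_x: "smooth_on (I \<times> J) x"
    unfolding assms(10) translation_surface_def case_prod_unfold
    by (intro smooth_on_add sm_fst sm_snd sm sm' t)
  have x_u: "partial_u (I \<times> J) x (u, v) = \<alpha> u *\<^sub>R (cross3 (\<nu>1 u) (\<nu>2 u))"
    and x_v: "partial_v (I \<times> J) x (u, v) = \<alpha>' v *\<^sub>R (cross3 (\<nu>1' v) (\<nu>2' v))"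
    if "u \<in> I" "v \<in> J" for u v
    using that by (simp_all add: assms(10) partial_translation_surface vel vel')
  have coeff1: "gfs_coefficients (I \<times> J) x (\<lambda>(u, v). \<nu>1 u) (\<lambda>(u, v). \<nu>2 u)
      (\<lambda>(u, v). - \<alpha> u * \<alpha>' v * T u v $ 3 $ 2) (\<lambda>(u, v). \<alpha> u * \<alpha>' v * T u v $ 3 $ 1)"
    unfolding gfs_coefficients_def
  proof (intro conjI sm_coeff sm_neg_coeff ballI, clarify)
    fix u v
    assume uv: "u \<in> I" "v \<in> J"
    \<comment> \<open>The third row of \<open>T\<close> holds the coordinates of the second curve's
      normal \<open>cross3 (\<nu>1' v) (\<nu>2' v)\<close> in the frame of the first.\<close>
    have *: "cross3 (\<nu>1' v) (\<nu>2' v) = T u v $ 3 $ 1 *\<^sub>R \<nu>1 u + T u v $ 3 $ 2 *\<^sub>R \<nu>2 u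
        + T u v $ 3 $ 3 *\<^sub>R (cross3 (\<nu>1 u) (\<nu>2 u))"
      using frame_expansion[OF fr[OF uv(1)], of "cross3 (\<nu>1' v) (\<nu>2' v)"] uv by (simp add: T_simps)
    \<comment> \<open>In the frame of the first curve, \<mu> \<times> \<nu>1 = \<nu>2, \<mu>
      \<times> \<nu>2 = -\<nu>1 and \<mu> \<times> \<mu> = 0. Hence the entry
      \<open>T u v $ 3 $ 3\<close> drops out and the minus sign falls on \<open>A\<close>.\<close>
    have "cross3 (cross3 (\<nu>1 u) (\<nu>2 u)) (cross3 (\<nu>1' v) (\<nu>2' v)) = T u v $ 3 $ 1 *\<^sub>R \<nu>2 u - T u v $ 3 $ 2 *\<^sub>R \<nu>1 u"
      unfolding * using Delta_frame[OF fr[OF uv(1)]] by (simp add: cross_add_right cross_mult_right)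
    then show "cross3 (partial_u (I \<times> J) x (u, v)) (partial_v (I \<times> J) x (u, v))
        = (- \<alpha> u * \<alpha>' v * T u v $ 3 $ 2) *\<^sub>R \<nu>1 u + (\<alpha> u * \<alpha>' v * T u v $ 3 $ 1) *\<^sub>R \<nu>2 u"
      using uv by (simp add: x_u x_v cross_mult_left cross_mult_right scaleR_diff_right mult_ac)
  qed
  have coeff2: "gfs_coefficients (I \<times> J) x (\<lambda>(u, v). \<nu>1' v) (\<lambda>(u, v). \<nu>2' v)
      (\<lambda>(u, v). \<alpha> u * \<alpha>' v * T u v $ 2 $ 3) (\<lambda>(u, v). - \<alpha> u * \<alpha>' v * T u v $ 1 $ 3)"
    unfolding gfs_coefficients_def
  proof (intro conjI sm_coeff sm_neg_coeff ballI, clarify)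
    fix u v
    assume uv: "u \<in> I" "v \<in> J"
    \<comment> \<open>Dually, the third column of \<open>T\<close> holds the coordinates of
      \<open>cross3 (\<nu>1 u) (\<nu>2 u)\<close> in the frame of the second curve;
      \<open>inner_commute\<close> reads the inner products in reverse order.\<close>
    have *: "cross3 (\<nu>1 u) (\<nu>2 u) = T u v $ 1 $ 3 *\<^sub>R \<nu>1' v + T u v $ 2 $ 3 *\<^sub>R \<nu>2' v
        + T u v $ 3 $ 3 *\<^sub>R (cross3 (\<nu>1' v) (\<nu>2' v))"
      using frame_expansion[OF fr'[OF uv(2)], of "cross3 (\<nu>1 u) (\<nu>2 u)"] uv
      by (simp add: T_simps inner_commute)
    \<comment> \<open>The expanded vector is now the left factor, so \<nu>1' \<times> \<mu>' =
      -\<nu>2' and \<nu>2' \<times> \<mu>' = \<nu>1' put the minus sign on \<open>B\<close>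
      instead.\<close>
    have "cross3 (cross3 (\<nu>1 u) (\<nu>2 u)) (cross3 (\<nu>1' v) (\<nu>2' v)) = T u v $ 2 $ 3 *\<^sub>R \<nu>1' v - T u v $ 1 $ 3 *\<^sub>R \<nu>2' v"
      unfolding * using Delta_frame[OF fr'[OF uv(2)]] by (simp add: cross_add_left cross_mult_left)
    then show "cross3 (partial_u (I \<times> J) x (u, v)) (partial_v (I \<times> J) x (u, v))
        = (\<alpha> u * \<alpha>' v * T u v $ 2 $ 3) *\<^sub>R \<nu>1' v + (- \<alpha> u * \<alpha>' v * T u v $ 1 $ 3) *\<^sub>R \<nu>2' v"
      using uv by (simp add: x_u x_v cross_mult_left cross_mult_right scaleR_diff_right mult_ac)
  qed
  have gfs1: "generalised_framed_surface (I \<times> J) x (\<lambda>(u, v). \<nu>1 u) (\<lambda>(u, v). \<nu>2 u)"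
    unfolding generalised_framed_surface_def
  proof (intro conjI exI)
    show "smooth_on (I \<times> J) (\<lambda>p. (x p, (case p of (u, v) \<Rightarrow> \<nu>1 u), case p of (u, v) \<Rightarrow> \<nu>2 u))"
      unfolding case_prod_unfold by (intro smooth_on_Pair t sm_x sm_fst sm)
  \<comment> \<open>The existential pair \<open>A\<close>, \<open>B\<close> is supplied by
    \<open>coeff1\<close>.\<close>
  qed (use dom coeff1 fr in auto)
  have gfs2: "generalised_framed_surface (I \<times> J) x (\<lambda>(u, v). \<nu>1' v) (\<lambda>(u, v). \<nu>2' v)"
    unfolding generalised_framed_surface_def
  proof (intro conjI exI)
    show "smooth_on (I \<times> J) (\<lambda>p. (x p, (case p of (u, v) \<Rightarrow> \<nu>1' v), case p of (u, v) \<Rightarrow> \<nu>2' v))"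
      unfolding case_prod_unfold by (intro smooth_on_Pair t sm_x sm_snd sm')
  qed (use dom coeff2 fr' in auto)
  have inv1: "abc_invariants (I \<times> J) x (\<lambda>(u, v). \<nu>1 u) (\<lambda>(u, v). \<nu>2 u) (u, v) =
        vector [vector [0, 0, \<alpha> u],
                vector [\<alpha>' v * T u v $ 3 $ 1, \<alpha>' v * T u v $ 3 $ 2, \<alpha>' v * T u v $ 3 $ 3]] \<and>
      efg_invariants (I \<times> J) (\<lambda>(u, v). \<nu>1 u) (\<lambda>(u, v). \<nu>2 u) (u, v) =
        vector [vector [l u, m u, n u], vector [0, 0, 0]]"
    if uv: "u \<in> I" "v \<in> J" for u v
    \<comment> \<open>The zeros arise because \<open>x_u\<close> is parallel to \<mu>, which is
      orthogonal to \<nu>1 and \<nu>2, and because the frame is constant in \<open>v\<close>. The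
      other entries are the curvature of the first curve and the inner products
      \<open>T\<close>.\<close>
    using Delta_frame[OF fr[OF uv(1)]] assms(7)[OF uv(1)] uv
    by (simp add: abc_invariants_def efg_invariants_def x_u x_v partial_Times_fst[OF tJ]
        curvature_def T_simps dot_cross_self)
  have inv2: "abc_invariants (I \<times> J) x (\<lambda>(u, v). \<nu>1' v) (\<lambda>(u, v). \<nu>2' v) (u, v) =
        vector [vector [\<alpha> u * T u v $ 1 $ 3, \<alpha> u * T u v $ 2 $ 3, \<alpha> u * T u v $ 3 $ 3],
                vector [0, 0, \<alpha>' v]] \<and>
      efg_invariants (I \<times> J) (\<lambda>(u, v). \<nu>1' v) (\<lambda>(u, v). \<nu>2' v) (u, v) =
        vector [vector [0, 0, 0], vector [l' v, m' v, n' v]]"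
    if uv: "u \<in> I" "v \<in> J" for u v
    using Delta_frame[OF fr'[OF uv(2)]] assms(8)[OF uv(2)] uv
    by (simp add: abc_invariants_def efg_invariants_def x_u x_v partial_Times_snd[OF tI]
        curvature_def T_simps dot_cross_self inner_commute)
  show ?thesis
    unfolding Let_def using gfs1 inv1 coeff1 gfs2 inv2 coeff2 by blast
qed

end
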